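(* Let $(w_i)_{i\in\mathbb{N}}$ be a sequence of positive real weights, and for each $n\ge 2$ let $\mathcal{D}_n^{w}$ denote the depth of node $n$ in a weighted recursive tree of size $n$ with these weights. If $\mathbb{E}[\mathcal{D}_n^w] \to \infty$ as $n\to\infty$ and $\limsup_{n \to \infty} \frac{w_n}{\sum_{i=1}^{n} w_i} < 1$, then $$\frac{\mathcal{D}_n^w - \mathbb{E}[\mathcal{D}_n^w ]}{\sqrt{\mathrm{Var}(\mathcal{D}_n^w )}}$$ converges in distribution to a standard normal random variable as $n\to\infty$.
   Context: Weighted recursive tree (WRT): given positive weights $(w_i)_{i\in\mathbb{N}}$, the WRT of size $n$ is the random rooted tree on nodes $1,\dots,n$ built as follows. Node $1$ is the root; for $j=2,\dots,n$ successively and independently of the previous steps, node $j$ is attached as a child to node $i\in\{1,\dots,j-1\}$ with probability $\frac{w_i}{w_1+\cdots+w_{j-1}}$. The depth of node $n$ is the length (number of edges) of the path from the root to $n$. *)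

theory Defs
  imports "HOL-Probability.Probability"
begin

(* Law of the node to which node j is attached, for j >= 2.  For positive weights the argument of
   embed_pmf is a probability mass function, see pmf_attach_pmf. *)
definition attach_pmf :: "(nat \<Rightarrow> real) \<Rightarrow> nat \<Rightarrow> nat pmf" where
  "attach_pmf w j = embed_pmf (\<lambda>i. if i \<in> {1..<j} then w i / (\<Sum>k\<in>{1..<j}. w k) else 0)"

(* A rooted tree on the nodes 1, ..., n with root 1 is represented by its set of edges
   (parent, child).  The case 0 is a dummy. *)
fun wrt_pmf :: "(nat \<Rightarrow> real) \<Rightarrow> nat \<Rightarrow> (nat \<times> nat) set pmf" where
  "wrt_pmf w 0 = return_pmf {}"
| "wrt_pmf w (Suc 0) = return_pmf {}"
| "wrt_pmf w (Suc (Suc n)) =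
     bind_pmf (wrt_pmf w (Suc n)) (\<lambda>T.
       map_pmf (\<lambda>i. insert (i, Suc (Suc n)) T) (attach_pmf w (Suc (Suc n))))"

(* T ^^ k relates two nodes iff a directed path with k edges leads from the first to the second.
   In a tree, k is unique, see relpow_wrt_ex1. *)
definition depth :: "(nat \<times> nat) set \<Rightarrow> nat \<Rightarrow> nat" where
  "depth T v = (THE k. (1, v) \<in> T ^^ k)"

definition wrt_depth_mean :: "(nat \<Rightarrow> real) \<Rightarrow> nat \<Rightarrow> real" where
  "wrt_depth_mean w n = measure_pmf.expectation (wrt_pmf w n) (\<lambda>T. real (depth T n))"

definition wrt_depth_var :: "(nat \<Rightarrow> real) \<Rightarrow> nat \<Rightarrow> real" where
  "wrt_depth_var w n = measure_pmf.variance (wrt_pmf w n) (\<lambda>T. real (depth T n))"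

lemma pmf_attach_pmf:
  assumes w: "\<And>i. i \<ge> 1 \<Longrightarrow> w i > 0" and "j \<ge> 2"
  shows "pmf (attach_pmf w j) i = (if i \<in> {1..<j} then w i / (\<Sum>k\<in>{1..<j}. w k) else 0)"
proof -
  define s where "s = (\<Sum>k\<in>{1..<j}. w k)"
  define f where "f = (\<lambda>i. if i \<in> {1..<j} then w i / s else 0)"
  have pos: "s > 0"
    unfolding s_def using assms by (intro sum_pos) auto
  have nonneg: "f i \<ge> 0" for i
    using w[of i] pos by (auto simp: f_def intro!: divide_nonneg_pos less_imp_le)
  have "(\<integral>\<^sup>+ x. ennreal (f x) \<partial>count_space UNIV) = (\<Sum>x\<in>{1..<j}. ennreal (f x))"
    by (rule nn_integral_count_space') (auto simp: f_def)
  also have "\<dots> = ennreal (\<Sum>x\<in>{1..<j}. f x)"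
    using nonneg by (intro sum_ennreal)
  also have "(\<Sum>x\<in>{1..<j}. f x) = (\<Sum>x\<in>{1..<j}. w x / s)"
    by (intro sum.cong) (auto simp: f_def)
  also have "\<dots> = 1"
    using pos by (simp add: s_def flip: sum_divide_distrib)
  finally have "pmf (embed_pmf f) i = f i"
    using nonneg by (intro pmf_embed_pmf) auto
  then show ?thesis
    unfolding attach_pmf_def f_def s_def .
qed

lemma wrt_edges:
  assumes w: "\<And>i. i \<ge> 1 \<Longrightarrow> w i > 0" and "T \<in> set_pmf (wrt_pmf w n)"
  shows "(\<forall>i j. (i, j) \<in> T \<longrightarrow> 1 \<le> i \<and> i < j \<and> j \<le> n)
    \<and> (\<forall>j. 2 \<le> j \<longrightarrow> j \<le> n \<longrightarrow> (\<exists>!i. (i, j) \<in> T))"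
  using assms(2)
proof (induction n arbitrary: T rule: nat_induct)
  case 0
  then show ?case by simp
next
  case (Suc n)
  show ?case
  proof (cases n)
    case 0
    then show ?thesis using Suc.prems by simp
  next
    case (Suc m)
    with Suc.prems obtain S i where T: "T = insert (i, Suc n) S" and S: "S \<in> set_pmf (wrt_pmf w n)"
      and "i \<in> set_pmf (attach_pmf w (Suc n))"
      by auto
    then have "pmf (attach_pmf w (Suc n)) i \<noteq> 0"
      by (simp add: set_pmf_iff)
    then have i: "1 \<le> i" "i < Suc n"
      using pmf_attach_pmf[of w "Suc n" i, OF w] Suc by (auto split: if_splits)
    have IH1: "1 \<le> a \<and> a < b \<and> b \<le> n" if "(a, b) \<in> S" for a b
      using Suc.IH[OF S] that by blast
    have IH2: "\<exists>!a. (a, b) \<in> S" if "2 \<le> b" "b \<le> n" for b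
      using Suc.IH[OF S] that by blast
    have "\<exists>!a. (a, b) \<in> T" if "2 \<le> b" "b \<le> Suc n" for b
    proof (cases "b = Suc n")
      case True
      then have "a = i" if "(a, b) \<in> T" for a
        using IH1[of a b] that T by auto
      then show ?thesis using T True by blast
    next
      case False
      then have "(a, b) \<in> T \<longleftrightarrow> (a, b) \<in> S" for a
        using T by auto
      then show ?thesis using IH2[of b] False that by simp
    qed
    moreover have "1 \<le> a \<and> a < b \<and> b \<le> Suc n" if "(a, b) \<in> T" for a b
      using IH1[of a b] that T i by auto
    ultimately show ?thesis by blast
  qed
qed

lemma relpow_wrt_ex1:
  assumes w: "\<And>i. i \<ge> 1 \<Longrightarrow> w i > 0" and T: "T \<in> set_pmf (wrt_pmf w n)" and "v \<in> {1..n}"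
  shows "\<exists>!k. (1, v) \<in> T ^^ k"
  using assms(3)
proof (induction v rule: less_induct)
  case (less v)
  have E: "(\<forall>i j. (i, j) \<in> T \<longrightarrow> 1 \<le> i \<and> i < j \<and> j \<le> n)
    \<and> (\<forall>j. 2 \<le> j \<longrightarrow> j \<le> n \<longrightarrow> (\<exists>!i. (i, j) \<in> T))"
    by (rule wrt_edges[OF _ T]) (rule w)
  have E1: "1 \<le> a \<and> a < b \<and> b \<le> n" if "(a, b) \<in> T" for a b
    using conjunct1[OF E, rule_format, OF that] .
  have E2: "\<exists>!a. (a, b) \<in> T" if "2 \<le> b" "b \<le> n" for b
    using conjunct2[OF E, rule_format, OF that] .
  show ?case
  proof (cases "v = 1")
    case True
    have "k = 0" if "(1, 1) \<in> T ^^ k" for k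
    proof (cases k)
      case (Suc l)
      then have "(1, 1) \<in> T ^^ l O T" using that by simp
      then obtain a where "(a, 1) \<in> T" by (rule relcompE) blast
      then show ?thesis using E1[of a 1] by simp
    qed simp
    moreover have "(1, 1) \<in> T ^^ 0" by simp
    ultimately have "\<exists>!k. (1, 1) \<in> T ^^ k" by (intro ex1I)
    then show ?thesis using True by (simp only:)
  next
    case False
    then have "2 \<le> v" "v \<le> n" using less.prems by auto
    then obtain i where i: "(i, v) \<in> T" and u: "\<And>i'. (i', v) \<in> T \<Longrightarrow> i' = i"
      using E2[of v] by blast
    have "i < v" "i \<in> {1..n}" using E1[OF i] by auto
    then have "\<exists>!k. (1, i) \<in> T ^^ k" by (rule less.IH)
    then obtain k where k: "(1, i) \<in> T ^^ k" and uk: "\<And>k'. (1, i) \<in> T ^^ k' \<Longrightarrow> k' = k"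
      by blast
    show ?thesis
    proof (rule ex1I[of _ "Suc k"])
      show "(1, v) \<in> T ^^ Suc k" using k i by (rule relpow_Suc_I)
    next
      fix l assume l: "(1, v) \<in> T ^^ l"
      show "l = Suc k"
      proof (cases l)
        case 0
        then show ?thesis using l False by simp
      next
        case (Suc l')
        then have "(1, v) \<in> T ^^ l' O T" using l by simp
        then obtain a where a: "(1, a) \<in> T ^^ l'" "(a, v) \<in> T"
          by (rule relcompE) blast
        show ?thesis using uk[of l'] a(1) Suc unfolding u[OF a(2)] by simp
      qed
    qed
  qed
qed

end

(* Node n + 1 has parent n with probability p n = w n / (w 1 + ... + w n), and given that its parent
   is some i < n, the parent has the law of the parent of n.  Hence the depth of n + 1 is distributed
   as the depth of n plus an independent Bernoulli variable with parameter p n, and the depth of n is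
   a sum of independent Bernoulli variables.  The limsup condition keeps p n away from 1, so the
   variance diverges together with the mean, and the Lyapunov condition holds because the summands
   are bounded.  On characteristic functions, which are products of Bernoulli factors, this is a
   factorwise comparison with Gaussian factors followed by Levy's continuity theorem. *)
theory Submission
  imports Defs
begin

section \<open>Gaussian approximation of centred Bernoulli factors\<close>

text \<open>The characteristic function at \<open>t\<close> of \<open>X - p\<close>, where
  \<open>X\<close> is Bernoulli with parameter \<open>p\<close>: the centred variable is
  \<open>- p\<close> with probability \<open>1 - p\<close> and \<open>1 - p\<close> with probability
  \<open>p\<close>.\<close>

definition bernoulli_centred_char :: "real \<Rightarrow> real \<Rightarrow> complex" where
  "bernoulli_centred_char p t = of_real (1 - p) * iexp (- (t * p)) + of_real p * iexp (t * (1 - p))"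

lemma norm_bernoulli_centred_char_le_1:
  assumes "0 \<le> p" "p \<le> 1"
  shows "norm (bernoulli_centred_char p t) \<le> 1"
proof -
  have "norm (bernoulli_centred_char p t) \<le>
      norm (of_real (1 - p) * iexp (- (t * p))) + norm (of_real p * iexp (t * (1 - p)))"
    unfolding bernoulli_centred_char_def by (rule norm_triangle_ineq)
  also have "norm (complex_of_real (1 - p) * iexp (- (t * p))) = 1 - p"
    unfolding norm_mult norm_exp_i_times norm_of_real using assms by simp
  also have "norm (of_real p * iexp (t * (1 - p))) = p"
    unfolding norm_mult norm_exp_i_times norm_of_real using assms by simp
  finally show ?thesis by simp
qed

text \<open>Expand both exponentials to second order. Centring cancels the linear terms, the
  quadratic terms add up to the variance \<open>p * (1 - p)\<close>, and the remainder is governed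
  by the third absolute moment, which is the variance times p^2 + (1 - p)^2 and hence at most the
  variance.\<close>

lemma bernoulli_centred_char_approx:
  assumes "0 \<le> p" "p \<le> 1"
  shows "norm (bernoulli_centred_char p t - of_real (1 - t\<^sup>2 * (p * (1 - p)) / 2))
    \<le> \<bar>t\<bar> ^ 3 * (p * (1 - p)) / 6"
proof -
  let ?e = "\<lambda>x. iexp x - (1 + \<i> * x - of_real (x\<^sup>2 / 2))"
  have e: "norm (?e x) \<le> \<bar>x\<bar> ^ 3 / 6" for x :: real
    using iexp_approx1[of x 2] by (simp add: eval_nat_numeral algebra_simps fact_numeral)
  have "bernoulli_centred_char p t - of_real (1 - t\<^sup>2 * (p * (1 - p)) / 2) =
      of_real (1 - p) * ?e (- (t * p)) + of_real p * ?e (t * (1 - p))"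
    unfolding bernoulli_centred_char_def by (simp add: field_simps power2_eq_square)
  also have "norm \<dots> \<le> norm (of_real (1 - p) * ?e (- (t * p))) + norm (of_real p * ?e (t * (1 - p)))"
    by (rule norm_triangle_ineq)
  also have "\<dots> = (1 - p) * norm (?e (- (t * p))) + p * norm (?e (t * (1 - p)))"
    unfolding norm_mult norm_of_real using assms by simp
  also have "\<dots> \<le> (1 - p) * (\<bar>- (t * p)\<bar> ^ 3 / 6) + p * (\<bar>t * (1 - p)\<bar> ^ 3 / 6)"
    using assms by (intro add_mono mult_left_mono e) auto
  also have "\<dots> = \<bar>t\<bar> ^ 3 * (p * (1 - p)) / 6 * (p\<^sup>2 + (1 - p)\<^sup>2)"
  proof -
    have "\<bar>- (t * p)\<bar> = \<bar>t\<bar> * p" "\<bar>t * (1 - p)\<bar> = \<bar>t\<bar> * (1 - p)"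
      using assms by (simp_all add: abs_mult)
    then show ?thesis
      by (simp only:) (simp add: field_simps power2_eq_square power3_eq_cube)
  qed
  also have "\<dots> \<le> \<bar>t\<bar> ^ 3 * (p * (1 - p)) / 6 * 1"
  proof (rule mult_left_mono)
    have "p\<^sup>2 + (1 - p)\<^sup>2 = 1 - 2 * (p * (1 - p))"
      by (simp add: power2_eq_square algebra_simps)
    then show "p\<^sup>2 + (1 - p)\<^sup>2 \<le> 1" using assms by simp
  qed (use assms in simp)
  finally show ?thesis by simp
qed

lemma exp_minus_approx:
  fixes x :: real
  assumes "0 \<le> x"
  shows "\<bar>exp (- x) - (1 - x)\<bar> \<le> x\<^sup>2"
proof -
  have 1: "1 - x \<le> exp (- x)"
    using exp_ge_add_one_self[of "- x"] by simp
  have "exp (- x) \<le> 1 / (1 + x)"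
    using exp_ge_add_one_self[of x] assms by (simp add: exp_minus field_simps)
  \<comment> \<open>Because (1 + x)(1 - x + x^2) = 1 + x^3 \<ge> 1.\<close>
  also have "\<dots> \<le> 1 - x + x\<^sup>2"
    using assms by (simp add: field_simps power2_eq_square)
  finally show ?thesis using 1 by simp
qed

text \<open>Both functions are compared with the same polynomial of second order. The error is kept
  proportional to the variance \<open>p * (1 - p)\<close>, so that summing it over the factors
  yields the total variance.\<close>

lemma bernoulli_centred_char_gauss_approx:
  assumes p: "0 \<le> p" "p \<le> 1"
  shows "norm (bernoulli_centred_char p t - of_real (exp (- (t\<^sup>2 * (p * (1 - p)) / 2))))
    \<le> (\<bar>t\<bar> ^ 3 + t ^ 4) * (p * (1 - p))"
proof -
  define v where "v = p * (1 - p)"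
  have v: "0 \<le> v" "v \<le> 1"
    using p by (auto simp: v_def intro!: mult_le_one)
  define x where "x = t\<^sup>2 * v / 2"
  have x: "0 \<le> x" using v by (simp add: x_def)
  have "norm (bernoulli_centred_char p t - of_real (exp (- x))) \<le>
      norm (bernoulli_centred_char p t - of_real (1 - x)) + norm (complex_of_real (1 - x) - of_real (exp (- x)))"
    by (rule order_trans[OF _ norm_triangle_ineq]) simp
  also have "norm (bernoulli_centred_char p t - of_real (1 - x)) \<le> \<bar>t\<bar> ^ 3 * v / 6"
    using bernoulli_centred_char_approx[OF p] by (simp add: x_def v_def)
  also have "norm (complex_of_real (1 - x) - of_real (exp (- x))) \<le> x\<^sup>2"
    using exp_minus_approx[OF x] unfolding of_real_diff[symmetric] norm_of_real
    by (simp add: abs_minus_commute)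
  also have "x\<^sup>2 = t ^ 4 * v / 4 * v"
    by (simp add: x_def power2_eq_square eval_nat_numeral)
  \<comment> \<open>One of the two factors \<open>v\<close> is bounded by 1 to make the error linear
    in \<open>v\<close>.\<close>
  also have "\<dots> \<le> t ^ 4 * v / 4 * 1"
    using v by (intro mult_left_mono) auto
  finally have "norm (bernoulli_centred_char p t - of_real (exp (- x))) \<le> \<bar>t\<bar> ^ 3 * v / 6 + t ^ 4 * v / 4"
    by simp
  also have "\<dots> \<le> (\<bar>t\<bar> ^ 3 + t ^ 4) * v"
  proof -
    have "0 \<le> \<bar>t\<bar> ^ 3 * v" "0 \<le> t ^ 4 * v" using v by auto
    then show ?thesis unfolding distrib_right by linarith
  qed
  finally show ?thesis by (simp add: x_def v_def)
qed

text \<open>At \<open>s = t / sqrt (V n)\<close> the Gaussian factors multiply to exactly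
  exp(-t^2/2). All factors have norm at most 1, so the two products differ by at most the sum of the
  factorwise errors, (|s|^3 + s^4) \<open>V n\<close> = |t|^3 / sqrt(\<open>V n\<close>) + t^4 /
  \<open>V n\<close>, which tends to 0.\<close>

lemma tendsto_prod_bernoulli_centred_char:
  fixes p :: "nat \<Rightarrow> real"
  assumes p: "\<And>i. 0 \<le> p i" "\<And>i. p i \<le> 1"
    and fin: "\<And>n. finite (A n)"
  defines "V \<equiv> \<lambda>n. \<Sum>i\<in>A n. p i * (1 - p i)"
  assumes V: "filterlim V at_top sequentially"
  shows "(\<lambda>n. \<Prod>i\<in>A n. bernoulli_centred_char (p i) (t / sqrt (V n)))
    \<longlonglongrightarrow> of_real (exp (- (t\<^sup>2 / 2)))"
proof -
  define g where "g = (\<lambda>n. \<Prod>i\<in>A n. complex_of_real (exp (- ((t / sqrt (V n))\<^sup>2 * (p i * (1 - p i)) / 2))))"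
  \<comment> \<open>If \<open>V n = 0\<close>, division by zero makes \<open>t / sqrt (V n)\<close>
    equal to 0 and \<open>g n\<close> equal to 1, so the exact value of \<open>g n\<close> is
    claimed only eventually.\<close>
  have pos: "eventually (\<lambda>n. V n > 0) sequentially"
    using V by (simp add: filterlim_at_top_dense)
  have g: "g n = of_real (exp (- (t\<^sup>2 / 2)))" if "V n > 0" for n
  proof -
    have "g n = of_real (exp (\<Sum>i\<in>A n. - ((t / sqrt (V n))\<^sup>2 * (p i * (1 - p i)) / 2)))"
      by (simp add: g_def exp_sum fin)
    also have "(\<Sum>i\<in>A n. - ((t / sqrt (V n))\<^sup>2 * (p i * (1 - p i)) / 2)) = - ((t / sqrt (V n))\<^sup>2 * V n / 2)"
      unfolding V_def by (simp add: sum_negf sum_distrib_left sum_divide_distrib)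
    also have "(t / sqrt (V n))\<^sup>2 * V n = t\<^sup>2"
      using that by (simp add: power_divide)
    finally show ?thesis .
  qed
  have bound: "norm ((\<Prod>i\<in>A n. bernoulli_centred_char (p i) (t / sqrt (V n))) - g n)
      \<le> \<bar>t\<bar> ^ 3 * inverse (sqrt (V n)) + t ^ 4 * inverse (V n)" if "V n > 0" for n
  proof -
    let ?s = "t / sqrt (V n)"
    have "norm ((\<Prod>i\<in>A n. bernoulli_centred_char (p i) ?s) - g n) \<le>
        (\<Sum>i\<in>A n. norm (bernoulli_centred_char (p i) ?s - of_real (exp (- (?s\<^sup>2 * (p i * (1 - p i)) / 2)))))"
      unfolding g_def using p
      by (intro norm_prod_diff norm_bernoulli_centred_char_le_1) auto
    also have "\<dots> \<le> (\<Sum>i\<in>A n. (\<bar>?s\<bar> ^ 3 + ?s ^ 4) * (p i * (1 - p i)))"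
      using p by (intro sum_mono bernoulli_centred_char_gauss_approx)
    also have "\<dots> = (\<bar>?s\<bar> ^ 3 + ?s ^ 4) * V n"
      by (simp add: V_def sum_distrib_left)
    also have "\<dots> = \<bar>t\<bar> ^ 3 * inverse (sqrt (V n)) + t ^ 4 * inverse (V n)"
    proof -
      define r where "r = sqrt (V n)"
      have "r > 0" "V n = r\<^sup>2" using that by (auto simp: r_def)
      then show ?thesis
        by (simp add: field_simps abs_divide power_divide flip: r_def) (simp add: eval_nat_numeral)
    qed
    finally show ?thesis .
  qed
  have inv: "(\<lambda>n. inverse (V n)) \<longlonglongrightarrow> 0" "(\<lambda>n. inverse (sqrt (V n))) \<longlonglongrightarrow> 0"
    using tendsto_inverse_0_at_top[OF V]
      tendsto_inverse_0_at_top[OF filterlim_compose[OF sqrt_at_top V]] by auto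
  have "(\<lambda>n. (\<Prod>i\<in>A n. bernoulli_centred_char (p i) (t / sqrt (V n))) - g n) \<longlonglongrightarrow> 0"
  proof (rule tendsto_norm_zero_cancel, rule tendsto_sandwich[OF _ _ tendsto_const])
    show "eventually (\<lambda>n. norm ((\<Prod>i\<in>A n. bernoulli_centred_char (p i) (t / sqrt (V n))) - g n)
      \<le> \<bar>t\<bar> ^ 3 * inverse (sqrt (V n)) + t ^ 4 * inverse (V n)) sequentially"
      using pos by eventually_elim (rule bound)
    show "(\<lambda>n. \<bar>t\<bar> ^ 3 * inverse (sqrt (V n)) + t ^ 4 * inverse (V n)) \<longlonglongrightarrow> 0"
      by (rule tendsto_eq_intros inv refl | simp)+
  qed simp
  moreover have "g \<longlonglongrightarrow> of_real (exp (- (t\<^sup>2 / 2)))"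
    by (rule tendsto_eventually) (use pos g in \<open>auto elim: eventually_mono\<close>)
  ultimately show ?thesis
    using tendsto_add by fastforce
qed

section \<open>Depths after attaching a new leaf\<close>

text \<open>The last edge of a path to an old node is not the new edge, and its source is a smaller,
  hence old, node; so the induction on the length stays among old nodes.\<close>

lemma relpow_insert_new_leaf:
  assumes "\<And>a b. (a, b) \<in> S \<Longrightarrow> a < b \<and> b \<le> n" and "v \<le> n"
  shows "(u, v) \<in> insert (i, Suc n) S ^^ k \<longleftrightarrow> (u, v) \<in> S ^^ k"
  using assms(2)
proof (induction k arbitrary: v)
  case (Suc k)
  have "(a, v) \<in> insert (i, Suc n) S \<longleftrightarrow> (a, v) \<in> S" for a
    using Suc.prems by auto
  then have "(u, v) \<in> insert (i, Suc n) S ^^ Suc k \<longleftrightarrow> (\<exists>a. (u, a) \<in> insert (i, Suc n) S ^^ k \<and> (a, v) \<in> S)"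
    by (auto simp del: insert_iff)
  also have "\<dots> \<longleftrightarrow> (\<exists>a. (u, a) \<in> S ^^ k \<and> (a, v) \<in> S)"
    using Suc.IH Suc.prems assms(1) by (meson less_le_trans less_imp_le)
  finally show ?case by auto
qed simp

lemma depth_insert_new_leaf_old:
  assumes "\<And>a b. (a, b) \<in> S \<Longrightarrow> a < b \<and> b \<le> n" and "v \<le> n"
  shows "depth (insert (i, Suc n) S) v = depth S v"
  using relpow_insert_new_leaf[OF assms] by (simp add: depth_def)

text \<open>The only edge into the new node comes from \<open>i\<close>, so the paths to it are
  those to \<open>i\<close> prolonged by one edge. Uniqueness of the path length to \<open>i\<close>
  carries over and determines the definite description in \<open>depth\<close>.\<close>

lemma depth_insert_new_leaf:
  assumes S: "\<And>a b. (a, b) \<in> S \<Longrightarrow> a < b \<and> b \<le> n" and i: "1 \<le> i" "i \<le> n"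
    and ex1: "\<exists>!k. (1, i) \<in> S ^^ k"
  shows "depth (insert (i, Suc n) S) (Suc n) = Suc (depth S i)"
proof -
  let ?T = "insert (i, Suc n) S"
  have step: "(1, Suc n) \<in> ?T ^^ Suc k \<longleftrightarrow> (1, i) \<in> S ^^ k" for k
  proof -
    have "(a, Suc n) \<in> ?T \<longleftrightarrow> a = i" for a
      using S[of a "Suc n"] by auto
    then have "(1, Suc n) \<in> ?T ^^ Suc k \<longleftrightarrow> (1, i) \<in> ?T ^^ k"
      by (simp add: relcomp_unfold del: insert_iff)
    also have "\<dots> \<longleftrightarrow> (1, i) \<in> S ^^ k"
      by (rule relpow_insert_new_leaf[OF S i(2)])
    finally show ?thesis .
  qed
  have d: "(1, i) \<in> S ^^ depth S i"
    unfolding depth_def using ex1 by (rule theI')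
  show ?thesis
    unfolding depth_def[of ?T]
  proof (rule the_equality)
    show "(1, Suc n) \<in> ?T ^^ Suc (depth S i)"
      using d step by blast
  next
    fix k assume k: "(1, Suc n) \<in> ?T ^^ k"
    show "k = Suc (depth S i)"
    proof (cases k)
      case 0
      then show ?thesis using k i by simp
    next
      case (Suc l)
      then show ?thesis using k step[of l] d ex1 by blast
    qed
  qed
qed

section \<open>Recursion for the law of the depth\<close>

context
  fixes w :: "nat \<Rightarrow> real"
  assumes w: "\<And>i. i \<ge> 1 \<Longrightarrow> w i > 0"
begin

lemma attach_prob_nonneg: "0 \<le> w n / (\<Sum>i=1..n. w i)"
  and attach_prob_le_1: "w n / (\<Sum>i=1..n. w i) \<le> 1"
proof -
  \<comment> \<open>For \<open>n = 0\<close> the sum is empty and division by zero gives 0, so the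
    bounds hold at every index.\<close>
  consider "n = 0" | "n \<ge> 1" by linarith
  then have "0 \<le> w n / (\<Sum>i=1..n. w i) \<and> w n / (\<Sum>i=1..n. w i) \<le> 1"
  proof cases
    case 2
    then have "0 < w n" "w n \<le> (\<Sum>i=1..n. w i)"
      using w by (auto intro!: member_le_sum simp: less_imp_le)
    then show ?thesis by simp
  qed simp
  then show "0 \<le> w n / (\<Sum>i=1..n. w i)" "w n / (\<Sum>i=1..n. w i) \<le> 1"
    by auto
qed

lemma set_pmf_attach_pmf: "j \<ge> 2 \<Longrightarrow> set_pmf (attach_pmf w j) \<subseteq> {1..<j}"
  using pmf_attach_pmf[of w j, OF w] by (auto simp: set_pmf_iff split: if_splits)

lemma wrt_pmf_Suc:
  "n \<ge> 1 \<Longrightarrow> wrt_pmf w (Suc n) =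
    bind_pmf (wrt_pmf w n) (\<lambda>T. map_pmf (\<lambda>i. insert (i, Suc n) T) (attach_pmf w (Suc n)))"
  by (cases n) simp_all

lemma wrt_edge_less:
  "T \<in> set_pmf (wrt_pmf w n) \<Longrightarrow> (a, b) \<in> T \<Longrightarrow> a < b \<and> b \<le> n"
  using wrt_edges[of w T n, OF w] by blast

text \<open>Finite support makes every function of the tree integrable.\<close>

lemma finite_set_pmf_wrt_pmf: "finite (set_pmf (wrt_pmf w n))"
proof (rule finite_subset)
  show "set_pmf (wrt_pmf w n) \<subseteq> Pow ({..n} \<times> {..n})"
    using wrt_edge_less[of _ n] by fastforce
qed simp

text \<open>Nodes arriving after \<open>i\<close> are leaves and do not change the depth of
  \<open>i\<close>, so their random parents integrate out.\<close>

lemma map_depth_wrt_pmf: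
  assumes "1 \<le> i" "i \<le> n"
  shows "map_pmf (\<lambda>T. depth T i) (wrt_pmf w n) = map_pmf (\<lambda>T. depth T i) (wrt_pmf w i)"
  using assms(2)
proof (induction n rule: dec_induct)
  case (step n)
  have "map_pmf (\<lambda>T. depth T i) (wrt_pmf w (Suc n)) =
      bind_pmf (wrt_pmf w n) (\<lambda>T. map_pmf (\<lambda>j. depth (insert (j, Suc n) T) i) (attach_pmf w (Suc n)))"
    using step.hyps assms by (simp add: wrt_pmf_Suc map_bind_pmf map_pmf_comp)
  also have "\<dots> = bind_pmf (wrt_pmf w n) (\<lambda>T. map_pmf (\<lambda>j. depth T i) (attach_pmf w (Suc n)))"
    using step.hyps depth_insert_new_leaf_old[OF wrt_edge_less]
    by (intro bind_pmf_cong map_pmf_cong refl) auto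
  also have "\<dots> = map_pmf (\<lambda>T. depth T i) (wrt_pmf w n)"
    by (simp add: map_pmf_const) (simp add: map_pmf_def)
  finally show ?case using step.IH by simp
qed simp

text \<open>The parent is drawn independently of the tree, so it may be drawn first; the depth of a
  parent \<open>i\<close> then has the law it already had in the tree of size
  \<open>i\<close>.\<close>

lemma depth_law_Suc_parent:
  assumes "n \<ge> 1"
  shows "map_pmf (\<lambda>T. depth T (Suc n)) (wrt_pmf w (Suc n)) =
    bind_pmf (attach_pmf w (Suc n)) (\<lambda>i. map_pmf Suc (map_pmf (\<lambda>T. depth T i) (wrt_pmf w i)))"
proof -
  have attach: "1 \<le> i \<and> i \<le> n" if "i \<in> set_pmf (attach_pmf w (Suc n))" for i
    using set_pmf_attach_pmf[of "Suc n"] assms that by auto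
  have "map_pmf (\<lambda>T. depth T (Suc n)) (wrt_pmf w (Suc n)) =
      bind_pmf (wrt_pmf w n) (\<lambda>T. map_pmf (\<lambda>i. depth (insert (i, Suc n) T) (Suc n)) (attach_pmf w (Suc n)))"
    using assms by (simp add: wrt_pmf_Suc map_bind_pmf map_pmf_comp)
  also have "\<dots> = bind_pmf (wrt_pmf w n) (\<lambda>T. map_pmf (\<lambda>i. Suc (depth T i)) (attach_pmf w (Suc n)))"
    using attach relpow_wrt_ex1[of w, OF w] depth_insert_new_leaf[OF wrt_edge_less]
    by (intro bind_pmf_cong map_pmf_cong refl) auto
  also have "\<dots> = bind_pmf (attach_pmf w (Suc n)) (\<lambda>i. map_pmf (\<lambda>T. Suc (depth T i)) (wrt_pmf w n))"
    unfolding map_pmf_def by (rule bind_commute_pmf)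
  also have "\<dots> = bind_pmf (attach_pmf w (Suc n)) (\<lambda>i. map_pmf Suc (map_pmf (\<lambda>T. depth T i) (wrt_pmf w n)))"
    by (simp add: map_pmf_comp)
  also have "\<dots> = bind_pmf (attach_pmf w (Suc n)) (\<lambda>i. map_pmf Suc (map_pmf (\<lambda>T. depth T i) (wrt_pmf w i)))"
    using attach by (intro bind_pmf_cong refl arg_cong[where f = "map_pmf Suc"] map_depth_wrt_pmf) auto
  finally show ?thesis .
qed

text \<open>A coin decides whether the parent is \<open>n\<close>; conditioned on being smaller, it
  is chosen proportionally to the weights below \<open>n\<close>, just as the parent of
  \<open>n\<close> is. For \<open>n = 1\<close> there would be no such smaller node.\<close>

lemma attach_pmf_Suc:
  assumes "n \<ge> 2"
  shows "attach_pmf w (Suc n) = bind_pmf (bernoulli_pmf (w n / (\<Sum>i=1..n. w i)))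
    (\<lambda>b. if b then return_pmf n else attach_pmf w n)"
proof (rule pmf_eqI)
  fix i
  define s where "s = (\<Sum>k\<in>{1..<n}. w k)"
  have s: "s > 0"
    unfolding s_def using w assms by (intro sum_pos) auto
  have sn: "(\<Sum>k\<in>{1..<Suc n}. w k) = s + w n" "(\<Sum>k=1..n. w k) = s + w n"
    using assms by (simp_all add: s_def flip: atLeastLessThanSuc_atLeastAtMost)
  have attach: "pmf (attach_pmf w j) i = (if i \<in> {1..<j} then w i / (\<Sum>k\<in>{1..<j}. w k) else 0)"
    if "j \<ge> n" for j
    using pmf_attach_pmf[of w j i] w assms that by simp
  have wn: "w n > 0" using w assms by simp
  define p where "p = w n / (s + w n)"
  have p: "0 \<le> p" "p \<le> 1" "1 - p = s / (s + w n)"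
    using s wn by (auto simp: p_def field_simps)
  have "pmf (bind_pmf (bernoulli_pmf p) (\<lambda>b. if b then return_pmf n else attach_pmf w n)) i =
      p * indicator {i} n + (1 - p) * pmf (attach_pmf w n) i"
    using p(1,2) by (simp add: pmf_bind)
  \<comment> \<open>For \<open>i < n\<close> the normalisation \<open>s\<close> cancels;
    \<open>i = n\<close> is reached only through the coin, since \<open>attach_pmf w n\<close> lives
    below \<open>n\<close>.\<close>
  also have "\<dots> = pmf (attach_pmf w (Suc n)) i"
    using assms s wn unfolding attach[OF order_refl] attach[OF le_SucI[OF order_refl]] sn(1) p(3) s_def[symmetric]
    by (auto simp: p_def indicator_def)
  finally show "pmf (attach_pmf w (Suc n)) i = pmf (bind_pmf (bernoulli_pmf (w n / (\<Sum>i=1..n. w i)))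
    (\<lambda>b. if b then return_pmf n else attach_pmf w n)) i"
    unfolding sn p_def by (rule sym)
qed

lemma attach_pmf_2: "attach_pmf w 2 = return_pmf 1"
  using set_pmf_attach_pmf[of 2] by (subst set_pmf_subset_singleton[symmetric]) auto

text \<open>On heads the parent is \<open>n\<close>, one level above. On tails the parent has the
  law of the parent of \<open>n\<close>, so the resulting depth has the law of the depth of
  \<open>n\<close>. This is an identity of laws, not of random variables on one tree.\<close>

lemma depth_law_Suc:
  assumes "n \<ge> 1"
  shows "map_pmf (\<lambda>T. depth T (Suc n)) (wrt_pmf w (Suc n)) =
    bind_pmf (bernoulli_pmf (w n / (\<Sum>i=1..n. w i)))
      (\<lambda>b. map_pmf (\<lambda>d. d + of_bool b) (map_pmf (\<lambda>T. depth T n) (wrt_pmf w n)))"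
proof -
  consider "n = 1" | "n \<ge> 2" using assms by linarith
  then show ?thesis
  proof cases
    case 1
    \<comment> \<open>Node 1 is the only possible parent, so the success probability
      \<open>w 1 / w 1\<close> is 1 and the coin is deterministic.\<close>
    have "bernoulli_pmf 1 = return_pmf True"
      by (rule pmf_eqI) (simp split: split_indicator)
    moreover have "w 1 \<noteq> 0" using w[of 1] by simp
    ultimately show ?thesis
      using 1 depth_law_Suc_parent[of 1] attach_pmf_2
      by (simp add: bind_return_pmf numeral_2_eq_2)
  next
    case 2
    let ?L = "\<lambda>i. map_pmf (\<lambda>T. depth T i) (wrt_pmf w i)"
    obtain m where m: "n = Suc m" "m \<ge> 1" using 2 by (cases n) auto
    \<comment> \<open>The tails branch is \<open>depth_law_Suc_parent\<close> for \<open>m\<close>,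
      read from right to left.\<close>
    have "bind_pmf (if b then return_pmf n else attach_pmf w n) (\<lambda>i. map_pmf Suc (?L i)) =
        map_pmf (\<lambda>d. d + of_bool b) (?L n)" for b
      using depth_law_Suc_parent[OF m(2)] m(1) by (simp add: bind_return_pmf)
    then show ?thesis
      using assms 2 by (simp only: depth_law_Suc_parent attach_pmf_Suc bind_assoc_pmf)
  qed
qed

section \<open>Mean, variance and characteristic function of the depth\<close>

text \<open>The values of \<open>f\<close> are left general so that the same recursion serves real
  moments and complex exponentials.\<close>

lemma expectation_depth_Suc:
  fixes f :: "nat \<Rightarrow> 'a :: {banach, second_countable_topology}"
  assumes "n \<ge> 1"
  defines "p \<equiv> w n / (\<Sum>i=1..n. w i)"
  shows "measure_pmf.expectation (wrt_pmf w (Suc n)) (\<lambda>T. f (depth T (Suc n))) =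
    (1 - p) *\<^sub>R measure_pmf.expectation (wrt_pmf w n) (\<lambda>T. f (depth T n)) +
    p *\<^sub>R measure_pmf.expectation (wrt_pmf w n) (\<lambda>T. f (Suc (depth T n)))"
proof -
  have "measure_pmf.expectation (wrt_pmf w (Suc n)) (\<lambda>T. f (depth T (Suc n))) =
      measure_pmf.expectation (map_pmf (\<lambda>T. depth T (Suc n)) (wrt_pmf w (Suc n))) f"
    by simp
  also have "\<dots> = (\<Sum>b\<in>UNIV. pmf (bernoulli_pmf p) b *\<^sub>R measure_pmf.expectation
      (map_pmf (\<lambda>d. d + of_bool b) (map_pmf (\<lambda>T. depth T n) (wrt_pmf w n))) f)"
    unfolding depth_law_Suc[OF assms(1)] p_def
    by (rule pmf_expectation_bind) (auto simp: finite_set_pmf_wrt_pmf)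
  finally show ?thesis
    using attach_prob_nonneg[of n] attach_prob_le_1[of n]
    by (simp add: UNIV_bool p_def)
qed

lemma depth_root: "T \<in> set_pmf (wrt_pmf w 1) \<Longrightarrow> depth T 1 = 0"
proof -
  assume "T \<in> set_pmf (wrt_pmf w 1)"
  then have "T = {}" by simp
  then have "(1, 1) \<in> T ^^ k \<longleftrightarrow> k = 0" for k
    by (cases k) auto
  then show ?thesis by (simp add: depth_def)
qed

lemma integrable_wrt_pmf:
  fixes f :: "_ \<Rightarrow> 'a :: {banach, second_countable_topology}"
  shows "integrable (measure_pmf (wrt_pmf w n)) f"
  by (rule integrable_measure_pmf_finite) (rule finite_set_pmf_wrt_pmf)

lemma expectation_depth_1:
  "measure_pmf.expectation (wrt_pmf w 1) (\<lambda>T. f (depth T 1)) = f 0"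
  for f :: "nat \<Rightarrow> 'a :: {banach, second_countable_topology}"
  using depth_root[of "{}"] by simp

lemma wrt_depth_mean_Suc:
  "n \<ge> 1 \<Longrightarrow> wrt_depth_mean w (Suc n) = wrt_depth_mean w n + w n / (\<Sum>i=1..n. w i)"
  using expectation_depth_Suc[of n real]
  by (simp add: wrt_depth_mean_def integrable_wrt_pmf algebra_simps)

lemma wrt_depth_mean_eq:
  assumes "n \<ge> 1"
  shows "wrt_depth_mean w n = (\<Sum>j\<in>{1..<n}. w j / (\<Sum>i=1..j. w i))"
  using assms
proof (induction n rule: dec_induct)
  case base
  show ?case using expectation_depth_1[of real] by (simp add: wrt_depth_mean_def)
next
  case (step n)
  then show ?case using wrt_depth_mean_Suc[of n] by simp
qed

text \<open>The variance of a sum of independent Bernoulli variables, obtained from the recursion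
  without constructing these variables.\<close>

lemma wrt_depth_var_eq:
  assumes "n \<ge> 1"
  shows "wrt_depth_var w n =
    (\<Sum>j\<in>{1..<n}. w j / (\<Sum>i=1..j. w i) * (1 - w j / (\<Sum>i=1..j. w i)))"
  using assms
proof (induction n rule: dec_induct)
  case base
  show ?case
    using expectation_depth_1[of "\<lambda>d. (real d - wrt_depth_mean w 1)\<^sup>2"] wrt_depth_mean_eq[of 1]
    by (simp add: wrt_depth_var_def wrt_depth_mean_def[symmetric])
next
  case (step n)
  define p where "p = w n / (\<Sum>i=1..n. w i)"
  define m where "m = wrt_depth_mean w n"
  let ?E = "measure_pmf.expectation (wrt_pmf w n)"
  have mean: "?E (\<lambda>T. real (depth T n)) = m"
    by (simp add: m_def wrt_depth_mean_def)
  have var: "?E (\<lambda>T. (real (depth T n) - m)\<^sup>2) = wrt_depth_var w n"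
    by (simp add: m_def wrt_depth_var_def wrt_depth_mean_def)
  \<comment> \<open>The cross term vanishes because the depth is centred at its mean
    \<open>m\<close>.\<close>
  have shift: "?E (\<lambda>T. (real (depth T n) - m + c)\<^sup>2) = wrt_depth_var w n + c\<^sup>2" for c
  proof -
    have "?E (\<lambda>T. (real (depth T n) - m + c)\<^sup>2) =
        ?E (\<lambda>T. (real (depth T n) - m)\<^sup>2 + 2 * c * (real (depth T n) - m) + c\<^sup>2)"
      by (simp add: power2_eq_square algebra_simps)
    also have "\<dots> = wrt_depth_var w n + c\<^sup>2"
      by (simp add: mean var integrable_wrt_pmf)
    finally show ?thesis .
  qed
  \<comment> \<open>The new mean is \<open>m + p\<close>, so the old centred depth is shifted by
    \<open>- p\<close> on tails and by \<open>1 - p\<close> on heads.\<close>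
  have "wrt_depth_var w (Suc n) =
      (1 - p) * ?E (\<lambda>T. (real (depth T n) - m + - p)\<^sup>2) + p * ?E (\<lambda>T. (real (depth T n) - m + (1 - p))\<^sup>2)"
    using expectation_depth_Suc[of n "\<lambda>d. (real d - (m + p))\<^sup>2"] step.hyps wrt_depth_mean_Suc[of n]
    by (simp add: wrt_depth_var_def wrt_depth_mean_def[symmetric] m_def p_def algebra_simps)
  also have "\<dots> = wrt_depth_var w n + p * (1 - p)"
    unfolding shift by (simp add: power2_eq_square algebra_simps)
  finally show ?case using step by (simp add: p_def)
qed

text \<open>Each new node moves the centre by \<open>p\<close> and adds an independent coin, which
  multiplies the expectation by one centred Bernoulli factor.\<close>

lemma expectation_iexp_depth:
  assumes "n \<ge> 1"
  shows "measure_pmf.expectation (wrt_pmf w n) (\<lambda>T. iexp (t * (real (depth T n) - wrt_depth_mean w n))) =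
    (\<Prod>j\<in>{1..<n}. bernoulli_centred_char (w j / (\<Sum>i=1..j. w i)) t)"
  using assms
proof (induction n rule: dec_induct)
  case base
  show ?case
    using expectation_depth_1[of "\<lambda>d. iexp (t * (real d - wrt_depth_mean w 1))"] wrt_depth_mean_eq[of 1]
    by simp
next
  case (step n)
  define p where "p = w n / (\<Sum>i=1..n. w i)"
  define m where "m = wrt_depth_mean w n"
  let ?E = "measure_pmf.expectation (wrt_pmf w n)"
  have "iexp (t * (real d - (m + p))) = iexp (t * (real d - m)) * iexp (- (t * p))"
    "iexp (t * (real (Suc d) - (m + p))) = iexp (t * (real d - m)) * iexp (t * (1 - p))" for d
    by (simp_all add: exp_add[symmetric] algebra_simps)
  then have "measure_pmf.expectation (wrt_pmf w (Suc n)) (\<lambda>T. iexp (t * (real (depth T (Suc n)) - (m + p)))) =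
      (1 - p) *\<^sub>R (?E (\<lambda>T. iexp (t * (real (depth T n) - m))) * iexp (- (t * p))) +
      p *\<^sub>R (?E (\<lambda>T. iexp (t * (real (depth T n) - m))) * iexp (t * (1 - p)))"
    using expectation_depth_Suc[of n "\<lambda>d. iexp (t * (real d - (m + p)))"] step.hyps
    by (simp only: integral_mult_left_zero p_def[symmetric])
  also have "\<dots> = ?E (\<lambda>T. iexp (t * (real (depth T n) - m))) * bernoulli_centred_char p t"
    by (simp only: bernoulli_centred_char_def scaleR_conv_of_real distrib_left mult.assoc mult.left_commute)
  finally show ?case
    using step wrt_depth_mean_Suc[of n] by (simp add: p_def m_def)
qed

section \<open>Divergence of the variance\<close>

text \<open>From some index \<open>N\<close> on, \<open>p j < c < 1\<close>, so each variance term
  is at least \<open>1 - c\<close> times the corresponding mean term. The earlier terms cost only a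
  constant.\<close>

lemma filterlim_wrt_depth_var:
  assumes mean: "filterlim (wrt_depth_mean w) at_top sequentially"
    and limsup: "limsup (\<lambda>n. ereal (w n / (\<Sum>i=1..n. w i))) < 1"
  shows "filterlim (wrt_depth_var w) at_top sequentially"
proof -
  define p where "p = (\<lambda>n. w n / (\<Sum>i=1..n. w i))"
  have p: "0 \<le> p n" "p n \<le> 1" for n
    using attach_prob_nonneg[of n] attach_prob_le_1[of n] by (auto simp: p_def)
  obtain c where c: "limsup (\<lambda>n. ereal (p n)) < ereal c" "ereal c < 1"
    using ereal_dense2[OF limsup] by (auto simp: p_def)
  obtain N where N: "\<And>n. n \<ge> N \<Longrightarrow> p n < c"
    using Limsup_lessD[OF c(1)] by (auto simp: eventually_sequentially)
  have c1: "c < 1" using c(2) by simp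
  have bound: "(1 - c) * (wrt_depth_mean w n - N) \<le> wrt_depth_var w n" if "n \<ge> 1" for n
  proof -
    \<comment> \<open>Subtracting 1 for \<open>j < N\<close> makes the left side nonpositive there,
      which gives one inequality valid for all \<open>j\<close>; the total subtracted is at most
      \<open>N\<close>.\<close>
    have "(1 - c) * (p j - (if j < N then 1 else 0)) \<le> p j * (1 - p j)" for j
    proof (cases "j < N")
      case True
      have "(1 - c) * (p j - 1) \<le> 0" "0 \<le> p j * (1 - p j)"
        using p[of j] c1 by (auto simp: mult_nonneg_nonpos)
      then show ?thesis using True by simp
    next
      case False
      then show ?thesis using p[of j] N[of j] by (auto simp: mult.commute intro!: mult_left_mono)
    qed
    then have "(\<Sum>j\<in>{1..<n}. (1 - c) * (p j - (if j < N then 1 else 0))) \<le> wrt_depth_var w n"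
      unfolding wrt_depth_var_eq[OF that] p_def by (intro sum_mono)
    also have "(\<Sum>j\<in>{1..<n}. (1 - c) * (p j - (if j < N then 1 else 0))) =
        (1 - c) * (wrt_depth_mean w n - (\<Sum>j\<in>{1..<n}. if j < N then 1 else 0))"
      unfolding wrt_depth_mean_eq[OF that] p_def by (simp only: sum_distrib_left[symmetric] sum_subtractf)
    finally have "(1 - c) * (wrt_depth_mean w n - (\<Sum>j\<in>{1..<n}. if j < N then 1 else 0)) \<le> wrt_depth_var w n" .
    moreover have "(\<Sum>j\<in>{1..<n}. if j < N then 1 else 0 :: real) \<le> real N"
    proof -
      have "(\<Sum>j\<in>{1..<n}. if j < N then 1 else 0 :: real) = real (card {j \<in> {1..<n}. j < N})"
        by (simp add: sum.If_cases Int_def)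
      also have "card {j \<in> {1..<n}. j < N} \<le> card {..<N}"
        by (rule card_mono) auto
      finally show ?thesis by simp
    qed
    then have "(1 - c) * (wrt_depth_mean w n - N) \<le>
        (1 - c) * (wrt_depth_mean w n - (\<Sum>j\<in>{1..<n}. if j < N then 1 else 0))"
      using c1 by (intro mult_left_mono) auto
    ultimately show ?thesis by linarith
  qed
  have "filterlim (\<lambda>n. (1 - c) * (- real N + wrt_depth_mean w n)) at_top sequentially"
    using c1 by (intro filterlim_tendsto_pos_mult_at_top[OF tendsto_const]
        filterlim_tendsto_add_at_top[OF tendsto_const] mean) auto
  then show ?thesis
    by (rule filterlim_at_top_mono)
      (auto intro!: exI[of _ 1] dest: bound simp: eventually_sequentially algebra_simps)
qed

end

section \<open>Asymptotic normality via characteristic functions\<close>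

theorem theorem5p2:
  fixes w :: "nat \<Rightarrow> real"
  assumes "\<And>i. i \<ge> 1 \<Longrightarrow> w i > 0"
    and "filterlim (wrt_depth_mean w) at_top sequentially"
    and "limsup (\<lambda>n. ereal (w n / (\<Sum>i=1..n. w i))) < 1"
  shows "weak_conv_m
    (\<lambda>n. distr (measure_pmf (wrt_pmf w n)) borel
      (\<lambda>T. (real (depth T n) - wrt_depth_mean w n) / sqrt (wrt_depth_var w n)))
    std_normal_distribution"
proof (rule levy_continuity)
  define p where "p = (\<lambda>n. w n / (\<Sum>i=1..n. w i))"
  fix t
  have p: "0 \<le> p n" "p n \<le> 1" for n
    unfolding p_def by (rule attach_prob_nonneg attach_prob_le_1; rule assms(1); assumption)+
  \<comment> \<open>The closed forms start at \<open>n = 1\<close>, as the tree of size 0 is a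
    dummy; hence the eventual statements.\<close>
  have var: "eventually (\<lambda>n. wrt_depth_var w n = (\<Sum>i\<in>{1..<n}. p i * (1 - p i))) sequentially"
    using wrt_depth_var_eq[of w] assms(1)
    by (auto simp: eventually_sequentially p_def intro!: exI[of _ 1])
  have V: "filterlim (\<lambda>n. \<Sum>i\<in>{1..<n}. p i * (1 - p i)) at_top sequentially"
    using filterlim_wrt_depth_var[of w] assms filterlim_cong[OF refl refl var] by blast
  \<comment> \<open>Dividing by the standard deviation amounts to rescaling the argument
    \<open>t\<close> of the characteristic function of the centred depth.\<close>
  have char: "char (distr (measure_pmf (wrt_pmf w n)) borel
      (\<lambda>T. (real (depth T n) - wrt_depth_mean w n) / sqrt (wrt_depth_var w n))) t =
      (\<Prod>i\<in>{1..<n}. bernoulli_centred_char (p i) (t / sqrt (wrt_depth_var w n)))" if "n \<ge> 1" for n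
    using expectation_iexp_depth[of w n "t / sqrt (wrt_depth_var w n)"] assms(1) that
    by (simp add: char_def integral_distr p_def)
  have "eventually (\<lambda>n. (\<Prod>i\<in>{1..<n}. bernoulli_centred_char (p i)
        (t / sqrt (\<Sum>i\<in>{1..<n}. p i * (1 - p i)))) =
      char (distr (measure_pmf (wrt_pmf w n)) borel
        (\<lambda>T. (real (depth T n) - wrt_depth_mean w n) / sqrt (wrt_depth_var w n))) t) sequentially"
    using var eventually_ge_at_top[of 1] by eventually_elim (drule sym, simp only: char)
  moreover have "(\<lambda>n. \<Prod>i\<in>{1..<n}. bernoulli_centred_char (p i)
      (t / sqrt (\<Sum>i\<in>{1..<n}. p i * (1 - p i)))) \<longlonglongrightarrow> char std_normal_distribution t"
    using tendsto_prod_bernoulli_centred_char[OF p _ V] by (simp add: char_std_normal_distribution)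
  ultimately show "(\<lambda>n. char (distr (measure_pmf (wrt_pmf w n)) borel
        (\<lambda>T. (real (depth T n) - wrt_depth_mean w n) / sqrt (wrt_depth_var w n))) t)
      \<longlonglongrightarrow> char std_normal_distribution t"
    by (rule Lim_transform_eventually[rotated])
qed (auto intro!: measure_pmf.prob_space_distr prob_space_normal_density
    simp: real_distribution_def real_distribution_axioms_def)

end
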